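(* Let $0<\alpha<1$ and assume that the $p$-values $p_1,\dots,p_n$ satisfy the PRDN property. Then any procedure that is compliant at level $\alpha$ obeys $$\mathrm{FDR}\le \alpha+\alpha\log\frac1\alpha .$$ In particular, this bound applies to the BH procedure at level $\alpha$.
   Context: The $p$-values $p_1,\dots,p_n$ are $[0,1]$-valued random variables. A fixed subset $\mathcal N_0\subset\{1,\dots,n\}$ of size $n_0\ge1$ indexes the true null hypotheses; the corresponding $p$-values are the null $p$-values, each stochastically larger than or equal to the uniform variable on $(0,1)$. A multiple testing procedure (measurably) outputs a set of rejected $p$-values. With $R$ the number of rejections and $V$ the number of rejected null $p$-values, $\mathrm{FDR}=\mathbb E[V/\max\{R,1\}]$. The procedure is compliant at level $\alpha$ if every rejected $p$-value $p_j$ satisfies $p_j\le\alpha R/n$. The BH procedure at level $\alpha$ takes $R=\max\{1\le j\le n:p_{(j)}\le\alpha j/n\}$ ($\max\emptyset=0$), where $p_{(1)}\le\cdots\le p_{(n)}$ are the ordered $p$-values, and rejects the $R$ hypotheses with $p_j\le\alpha R/n$ (none if $R=0$). PRDN (positive regression dependence within nulls): a (measurable) set $D\subset[0,1]^{n_0}$ is increasing if $x\in D$ and $x\preceq y\preceq 1$ coordinatewise imply $y\in D$. The $p$-values satisfy PRDN if for every increasing set $D\subset[0,1]^{n_0}$ and every $i\in\mathcal N_0$, the conditional probability $\mathbb P\big((p_j)_{j\in\mathcal N_0}\in D\mid p_i\le t\big)$ is non-decreasing in $t\in(0,1]$ (considered for those $t$ with $\mathbb P(p_i\le t)>0$). No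 assumption is made on the non-null $p$-values or their dependence on the null ones. *)

theory Defs
  imports "HOL-Probability.Probability"
begin

definition stochastically_ge :: "real measure \<Rightarrow> real measure \<Rightarrow> bool" where
  "stochastically_ge \<mu> \<nu> \<longleftrightarrow> (\<forall>t. measure \<mu> {..t} \<le> measure \<nu> {..t})"

definition p_values :: "'a measure \<Rightarrow> nat \<Rightarrow> nat set \<Rightarrow> (nat \<Rightarrow> 'a \<Rightarrow> real) \<Rightarrow> bool" where
  "p_values M n N0 p \<longleftrightarrow>
     (\<forall>j\<in>{1..n}. p j \<in> borel_measurable M \<and> (\<forall>\<omega>\<in>space M. p j \<omega> \<in> {0..1})) \<and>
     (\<forall>i\<in>N0. stochastically_ge (distr M borel (p i)) (uniform_measure lborel {0<..<1}))"

text \<open>The cube \<open>[0,1]\<close> to the power \<open>n\<^sub>0\<close> is indexed by the set \<open>N0\<close> itself, so its points are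
  extensional functions on \<open>N0\<close>.\<close>

definition increasing_set :: "nat set \<Rightarrow> (nat \<Rightarrow> real) set \<Rightarrow> bool" where
  "increasing_set N0 D \<longleftrightarrow>
     D \<subseteq> (N0 \<rightarrow>\<^sub>E {0..1}) \<and>
     (\<forall>x\<in>D. \<forall>y\<in>N0 \<rightarrow>\<^sub>E {0..1}. (\<forall>j\<in>N0. x j \<le> y j) \<longrightarrow> y \<in> D)"

definition PRDN :: "'a measure \<Rightarrow> nat set \<Rightarrow> (nat \<Rightarrow> 'a \<Rightarrow> real) \<Rightarrow> bool" where
  "PRDN M N0 p \<longleftrightarrow>
     (\<forall>D. \<forall>i\<in>N0. D \<in> sets (\<Pi>\<^sub>M j\<in>N0. borel) \<and> increasing_set N0 D \<longrightarrow>
       mono_on {t \<in> {0<..1}. \<P>(\<omega> in M. p i \<omega> \<le> t) > 0}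
         (\<lambda>t. \<P>(\<omega> in M. (\<lambda>j\<in>N0. p j \<omega>) \<in> D \<bar> p i \<omega> \<le> t)))"

text \<open>A procedure is represented by its random set of rejected indices. It need not be a function
  of the p-values; a rule applied to the p-values is the special case
  \<open>\<lambda>\<omega>. rule (\<lambda>j. p j \<omega>)\<close>.\<close>

definition testing_procedure :: "'a measure \<Rightarrow> nat \<Rightarrow> ('a \<Rightarrow> nat set) \<Rightarrow> bool" where
  "testing_procedure M n Rej \<longleftrightarrow> Rej \<in> M \<rightarrow>\<^sub>M count_space (Pow {1..n})"

definition compliant ::
    "'a measure \<Rightarrow> nat \<Rightarrow> (nat \<Rightarrow> 'a \<Rightarrow> real) \<Rightarrow> real \<Rightarrow> ('a \<Rightarrow> nat set) \<Rightarrow> bool" where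
  "compliant M n p \<alpha> Rej \<longleftrightarrow>
     (\<forall>\<omega>\<in>space M. \<forall>j\<in>Rej \<omega>. p j \<omega> \<le> \<alpha> * real (card (Rej \<omega>)) / real n)"

definition FDR :: "'a measure \<Rightarrow> nat set \<Rightarrow> ('a \<Rightarrow> nat set) \<Rightarrow> real" where
  "FDR M N0 Rej =
     (\<integral>\<omega>. real (card (Rej \<omega> \<inter> N0)) / real (max (card (Rej \<omega>)) 1) \<partial>M)"

text \<open>The \<open>j\<close>-th smallest (counted with multiplicity) of \<open>x 1, \<dots>, x n\<close>; lists are indexed from \<open>0\<close>.\<close>

definition order_stat :: "nat \<Rightarrow> (nat \<Rightarrow> real) \<Rightarrow> nat \<Rightarrow> real" where
  "order_stat n x j = sort (map x [1..<Suc n]) ! (j - 1)"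

definition BH_count :: "nat \<Rightarrow> real \<Rightarrow> (nat \<Rightarrow> real) \<Rightarrow> nat" where
  "BH_count n \<alpha> x =
     (let S = {j \<in> {1..n}. order_stat n x j \<le> \<alpha> * real j / real n}
      in if S = {} then 0 else Max S)"

definition BH :: "nat \<Rightarrow> real \<Rightarrow> (nat \<Rightarrow> real) \<Rightarrow> nat set" where
  "BH n \<alpha> x =
     (if BH_count n \<alpha> x = 0 then {}
      else {j \<in> {1..n}. x j \<le> \<alpha> * real (BH_count n \<alpha> x) / real n})"

end

theory Submission
  imports Defs
begin

text \<open>If \<open>V\<close> of \<open>R\<close> rejections are null and \<open>V / R \<ge> u\<close>, compliance puts all \<open>V\<close> null p-values
  below \<open>\<alpha> R / n \<le> (\<alpha> / u) V / n\<^sub>0\<close>, so the Simes test on the null p-values rejects at level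
  \<open>\<alpha> / u\<close>. Under PRDN this has probability at most \<open>\<alpha> / u\<close> (Simes' inequality); integrating
  \<open>min 1 (\<alpha> / u)\<close> over \<open>u \<in> [0,1]\<close> gives \<open>\<alpha> + \<alpha> ln (1 / \<alpha>)\<close>.\<close>

section \<open>From a tail bound to a bound on the mean\<close>

text \<open>Layer-cake argument cut at \<open>a\<close>: levels up to \<open>a\<close> contribute at
  most \<open>a\<close> to the mean, and each level \<open>u\<close> in (a, 1] contributes its tail
  probability, at most \<open>a / u\<close>.\<close>

lemma (in prob_space) integral_le_log_of_tail_bound:
  fixes X :: "'a \<Rightarrow> real"
  assumes X[measurable]: "X \<in> borel_measurable M"
    and bounds: "\<And>\<omega>. \<omega> \<in> space M \<Longrightarrow> 0 \<le> X \<omega> \<and> X \<omega> \<le> 1"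
    and a: "0 < a" "a \<le> 1"
    and tail: "\<And>u. a < u \<Longrightarrow> u \<le> 1 \<Longrightarrow> prob {\<omega>\<in>space M. u \<le> X \<omega>} \<le> a / u"
  shows "(\<integral>\<omega>. X \<omega> \<partial>M) \<le> a + a * ln (1 / a)"
proof (rule integral_real_bounded)
  interpret pair_sigma_finite M lborel ..
  have ln_nonneg: "0 \<le> a * ln (1 / a)"
    using a by simp
  then show "0 \<le> a + a * ln (1 / a)"
    using a by simp
  \<comment> \<open>For fixed \<open>\<omega>\<close> this region has length
    \<open>X \<omega> - a\<close>, or 0 if that is negative; for fixed \<open>u\<close> its mass is
    the tail probability at \<open>u\<close>. Fubini links the two.\<close>
  let ?f = "\<lambda>\<omega> u. indicator {u. a < u \<and> u \<le> 1 \<and> u \<le> X \<omega>} u :: ennreal"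
  have meas: "case_prod ?f \<in> borel_measurable (M \<Otimes>\<^sub>M lborel)"
    by (simp add: case_prod_beta' indicator_def) measurable
  have "(\<integral>\<^sup>+\<omega>. ennreal (X \<omega>) \<partial>M) \<le> (\<integral>\<^sup>+\<omega>. ennreal a + (\<integral>\<^sup>+u. ?f \<omega> u \<partial>lborel) \<partial>M)"
  proof (rule nn_integral_mono)
    fix \<omega> assume "\<omega> \<in> space M"
    then have "{u. a < u \<and> u \<le> 1 \<and> u \<le> X \<omega>} = {a<..X \<omega>}"
      using bounds[of \<omega>] by (auto intro: order_trans)
    then have "(\<integral>\<^sup>+u. ?f \<omega> u \<partial>lborel) = emeasure lborel {a<..X \<omega>}"
      by simp
    also have "\<dots> = ennreal (X \<omega> - a)"
      by (cases "a \<le> X \<omega>") (auto simp: ennreal_neg)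
    finally show "ennreal (X \<omega>) \<le> ennreal a + (\<integral>\<^sup>+u. ?f \<omega> u \<partial>lborel)"
      using a by (cases "a \<le> X \<omega>") (auto simp: ennreal_plus[symmetric] ennreal_leI simp del: ennreal_plus)
  qed
  also have "\<dots> = ennreal a + (\<integral>\<^sup>+\<omega>. (\<integral>\<^sup>+u. ?f \<omega> u \<partial>lborel) \<partial>M)"
    using meas by (subst nn_integral_add) (auto simp: emeasure_space_1 intro!: lborel.borel_measurable_nn_integral)
  also have "(\<integral>\<^sup>+\<omega>. (\<integral>\<^sup>+u. ?f \<omega> u \<partial>lborel) \<partial>M) = (\<integral>\<^sup>+u. (\<integral>\<^sup>+\<omega>. ?f \<omega> u \<partial>M) \<partial>lborel)"
    by (rule Fubini'[OF meas, symmetric])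
  also have "\<dots> \<le> (\<integral>\<^sup>+u. ennreal (a / u) * indicator {a..1} u \<partial>lborel)"
  proof (rule nn_integral_mono)
    fix u :: real
    show "(\<integral>\<^sup>+\<omega>. ?f \<omega> u \<partial>M) \<le> ennreal (a / u) * indicator {a..1} u"
    proof (cases "a < u \<and> u \<le> 1")
      case True
      have "(\<integral>\<^sup>+\<omega>. ?f \<omega> u \<partial>M) = (\<integral>\<^sup>+\<omega>. indicator {\<omega>\<in>space M. u \<le> X \<omega>} \<omega> \<partial>M)"
        using True by (intro nn_integral_cong) (auto simp: indicator_def)
      also have "\<dots> = ennreal (prob {\<omega>\<in>space M. u \<le> X \<omega>})"
        by (simp add: emeasure_eq_measure)
      also have "\<dots> \<le> ennreal (a / u)"
        using tail True by (intro ennreal_leI) auto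
      finally show ?thesis
        using True by simp
    qed (auto simp: indicator_def)
  qed
  \<comment> \<open>\<open>a * ln u\<close> is an antiderivative of \<open>a / u\<close>, which is
    regular on the closed interval because \<open>a > 0\<close>.\<close>
  also have "\<dots> = ennreal (a * ln 1 - a * ln a)"
    using a by (intro nn_integral_FTC_Icc) (auto intro!: derivative_eq_intros simp: field_simps)
  also have "ennreal a + ennreal (a * ln 1 - a * ln a) = ennreal (a + a * ln (1 / a))"
    using a ln_nonneg by (simp add: ennreal_plus[symmetric] ln_div del: ennreal_plus)
  finally show "(\<integral>\<^sup>+\<omega>. ennreal (X \<omega>) \<partial>M) \<le> ennreal (a + a * ln (1 / a))"
    by (simp add: add_left_mono)
qed

section \<open>Simes' inequality under PRDN\<close>

lemma p_values_prob_le: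
  assumes "prob_space M" "p_values M n N0 p" "N0 \<subseteq> {1..n}" "i \<in> N0" "0 \<le> t" "t \<le> 1"
  shows "measure M {\<omega>\<in>space M. p i \<omega> \<le> t} \<le> t"
proof -
  have [measurable]: "p i \<in> borel_measurable M"
    using assms by (auto simp: p_values_def)
  have "measure M {\<omega>\<in>space M. p i \<omega> \<le> t} = measure (distr M borel (p i)) {..t}"
    by (simp add: measure_distr vimage_def Int_def conj_commute)
  also have "\<dots> \<le> measure (uniform_measure lborel {0<..<1}) {..t}"
    using assms by (auto simp: p_values_def stochastically_ge_def)
  also have "\<dots> = measure lborel ({0<..<1} \<inter> {..t})"
    by (subst measure_uniform_measure) auto
  also have "\<dots> \<le> measure lborel {0..t}"
    using assms by (intro measure_mono_fmeasurable) (auto simp: fmeasurable_def)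
  finally show ?thesis
    using assms by simp
qed

text \<open>Raising coordinates can only lower the counts. With \<open>K\<close> the ranks above
  some \<open>k\<close> and \<open>c\<close> the Simes thresholds, this is the increasing set to
  which PRDN is applied.\<close>

lemma increasing_set_count_less:
  assumes "finite N0"
  shows "increasing_set N0 {y \<in> N0 \<rightarrow>\<^sub>E {0..1}. \<forall>m\<in>K. card {j\<in>N0. y j \<le> c m} < m}"
proof -
  have "card {j\<in>N0. y j \<le> b} \<le> card {j\<in>N0. x j \<le> b}"
    if "\<forall>j\<in>N0. x j \<le> y j" for x y :: "nat \<Rightarrow> real" and b
    using assms that by (intro card_mono) (auto intro: order_trans)
  then show ?thesis
    unfolding increasing_set_def by (fastforce intro: le_less_trans)
qed

text \<open>The left-hand side is the probability that the Simes test on the null p-values rejects at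
  level \<open>x\<close>.\<close>

lemma Simes_PRDN:
  assumes "prob_space M" and N0: "N0 \<subseteq> {1..n}" and pv: "p_values M n N0 p"
    and PRDN: "PRDN M N0 p" and x: "0 < x" "x \<le> 1"
  defines "t \<equiv> \<lambda>k. x * real k / real (card N0)"
  shows "measure M {\<omega>\<in>space M. \<exists>k\<in>{1..card N0}. k \<le> card {j\<in>N0. p j \<omega> \<le> t k}} \<le> x"
proof -
  interpret prob_space M by fact
  define n0 where "n0 = card N0"
  have fin: "finite N0"
    using N0 by (rule finite_subset) simp
  have pm: "p j \<in> borel_measurable M" if "j \<in> N0" for j
    using pv N0 that by (auto simp: p_values_def)
  note pm[measurable]
  define cnt where "cnt k \<omega> = card {j\<in>N0. p j \<omega> \<le> t k}" for k \<omega>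
  have cnt_meas[measurable]: "cnt k \<in> measurable M (count_space UNIV)" for k
    unfolding cnt_def by measurable
  \<comment> \<open>the event that BH at level \<open>x\<close> on the null p-values makes at most \<open>k\<close> rejections\<close>
  define E where "E k = {\<omega>\<in>space M. \<forall>m\<in>{k<..n0}. cnt m \<omega> < m}" for k
  have E_meas[measurable]: "E k \<in> sets M" for k
    unfolding E_def by measurable
  have E_mono: "E k \<subseteq> E (Suc k)" for k
    by (auto simp: E_def)
  define A where "A i k = {\<omega>\<in>space M. p i \<omega> \<le> t k}" for i k
  have A_meas[measurable]: "A i k \<in> sets M" if "i \<in> N0" for i k
    using that unfolding A_def by measurable
  \<comment> \<open>conditional probability, with value 0 whenever the condition has probability 0\<close>
  define q where "q i k l = prob (E k \<inter> A i l) / prob (A i l)" for i k l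
  have t_Icc: "0 \<le> t k" "t k \<le> x" if "k \<le> n0" for k
    using that x by (auto simp: t_def n0_def divide_le_eq mult_left_le)
  have prob_A: "prob (A i k) \<le> t k" if "i \<in> N0" "k \<le> n0" for i k
    unfolding A_def using that t_Icc[of k] x N0 pv \<open>prob_space M\<close>
    by (intro p_values_prob_le) auto
  \<comment> \<open>\<open>E k\<close> is an increasing event; this is the only use of PRDN, and it makes \<open>step\<close> telescope\<close>
  have q_mono: "q i k k \<le> q i k (Suc k)" if i: "i \<in> N0" and k: "Suc k \<le> n0" for i k
  proof (cases "prob (A i k) = 0")
    case True
    then show ?thesis by (simp add: q_def)
  next
    case False
    have "A i k \<subseteq> A i (Suc k)"
      using x by (auto simp: A_def t_def elim!: order_trans intro!: divide_right_mono)
    with False have pos: "prob (A i k) > 0" "prob (A i (Suc k)) > 0"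
      using finite_measure_mono[of "A i k" "A i (Suc k)"] i
      by (auto simp: zero_less_measure_iff simp flip: measure_le_0_iff)
    \<comment> \<open>PRDN compares only thresholds in (0, 1] of positive probability. By
      \<open>prob_A\<close>, positive probability forces a positive threshold; so
      \<open>k = 0\<close>, where \<open>t 0 = 0\<close>, always falls under the first case.\<close>
    have tk: "t k \<in> {0<..1}" "t (Suc k) \<in> {0<..1}"
      using pos prob_A[of i k] prob_A[of i "Suc k"] t_Icc[of k] t_Icc[of "Suc k"] i k x by auto
    \<comment> \<open>The event \<open>E k\<close> expressed through the null p-values alone, as a
      subset of the cube.\<close>
    define D where
      "D = {y \<in> N0 \<rightarrow>\<^sub>E {0..1}. \<forall>m\<in>{k<..n0}. card {j\<in>N0. y j \<le> t m} < m}"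
    have D_sets: "D \<in> sets (\<Pi>\<^sub>M j\<in>N0. borel)"
    proof -
      have [measurable]: "(\<lambda>y. card {j\<in>N0. y j \<le> t m})
          \<in> measurable (\<Pi>\<^sub>M j\<in>N0. borel) (count_space UNIV)" for m
        by measurable
      have "(N0 \<rightarrow>\<^sub>E {0..1::real}) \<in> sets (\<Pi>\<^sub>M j\<in>N0. borel)"
        using fin by (intro sets_PiM_I_finite) auto
      moreover have "{y \<in> space (\<Pi>\<^sub>M j\<in>N0. borel). \<forall>m\<in>{k<..n0}. card {j\<in>N0. y j \<le> t m} < m}
          \<in> sets (\<Pi>\<^sub>M j\<in>N0. borel)"
        by measurable
      ultimately have "(N0 \<rightarrow>\<^sub>E {0..1::real}) \<inter>
          {y \<in> space (\<Pi>\<^sub>M j\<in>N0. borel). \<forall>m\<in>{k<..n0}. card {j\<in>N0. y j \<le> t m} < m}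
          \<in> sets (\<Pi>\<^sub>M j\<in>N0. borel)"
        by (rule sets.Int)
      also have "(N0 \<rightarrow>\<^sub>E {0..1::real}) \<inter>
          {y \<in> space (\<Pi>\<^sub>M j\<in>N0. borel). \<forall>m\<in>{k<..n0}. card {j\<in>N0. y j \<le> t m} < m} = D"
        by (auto simp: D_def space_PiM PiE_def)
      finally show ?thesis .
    qed
    have D_inc: "increasing_set N0 D"
      unfolding D_def by (rule increasing_set_count_less[OF fin])
    have D_iff: "(\<lambda>j\<in>N0. p j \<omega>) \<in> D \<longleftrightarrow> \<omega> \<in> E k" if "\<omega> \<in> space M" for \<omega>
    proof -
      have "(\<lambda>j\<in>N0. p j \<omega>) \<in> N0 \<rightarrow>\<^sub>E {0..1}"
        using pv N0 that by (auto simp: p_values_def)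
      moreover have "{j\<in>N0. (\<lambda>j\<in>N0. p j \<omega>) j \<le> c} = {j\<in>N0. p j \<omega> \<le> c}" for c
        by auto
      ultimately show ?thesis
        using that by (simp add: D_def E_def cnt_def)
    qed
    have q_eq: "q i k l = \<P>(\<omega> in M. (\<lambda>j\<in>N0. p j \<omega>) \<in> D \<bar> p i \<omega> \<le> t l)" for l
    proof -
      have "{\<omega>\<in>space M. (\<lambda>j\<in>N0. p j \<omega>) \<in> D \<and> p i \<omega> \<le> t l} = E k \<inter> A i l"
        using D_iff by (auto simp: A_def E_def)
      then show ?thesis
        by (simp add: q_def cond_prob_def A_def)
    qed
    have mono: "mono_on {t \<in> {0<..1}. \<P>(\<omega> in M. p i \<omega> \<le> t) > 0}
         (\<lambda>t. \<P>(\<omega> in M. (\<lambda>j\<in>N0. p j \<omega>) \<in> D \<bar> p i \<omega> \<le> t))"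
      using PRDN D_sets D_inc i unfolding PRDN_def by blast
    have "t k \<le> t (Suc k)"
      using x by (auto simp: t_def intro!: divide_right_mono)
    with tk pos show ?thesis
      unfolding q_eq by (intro mono_onD[OF mono]) (simp_all add: A_def)
  qed
  \<comment> \<open>The difference is the event that BH on the null p-values makes exactly
    \<open>Suc k\<close> rejections. Its probability is shared equally among the rejected indices,
    each receiving \<open>1 / Suc k\<close>. Superuniformity turns this weight into
    \<open>x / n0\<close> divided by \<open>prob (A i (Suc k))\<close>, that is, into a difference
    of conditional probabilities.\<close>
  have step: "prob (E (Suc k) - E k) \<le> (\<Sum>i\<in>N0. x / n0 * (q i (Suc k) (Suc k) - q i k k))"
    if k: "Suc k \<le> n0" for k
  proof -
    let ?B = "E (Suc k) - E k"
    \<comment> \<open>\<open>Suc k\<close> is the only rank constrained by \<open>E k\<close> but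
      not by \<open>E (Suc k)\<close>, so on \<open>?B\<close> it is the rank whose constraint
      fails: at least \<open>Suc k\<close> of the events \<open>A i (Suc k)\<close> occur.\<close>
    have "real (Suc k) * indicator ?B \<omega> \<le> (\<Sum>i\<in>N0. indicator (?B \<inter> A i (Suc k)) \<omega> :: real)" for \<omega>
    proof (cases "\<omega> \<in> ?B")
      case True
      then have "Suc k \<le> cnt (Suc k) \<omega>" "\<omega> \<in> space M"
        by (auto simp: E_def not_less) (metis Suc_leI greaterThanAtMost_iff le_neq_implies_less not_le)
      moreover have "(\<Sum>i\<in>N0. indicator (?B \<inter> A i (Suc k)) \<omega> :: real) = real (cnt (Suc k) \<omega>)"
        using True fin \<open>\<omega> \<in> space M\<close>
        by (simp add: cnt_def A_def indicator_def sum.If_cases Int_def)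
      ultimately show ?thesis
        using True by simp
    qed (auto intro: sum_nonneg)
    then have "(\<integral>\<omega>. real (Suc k) * indicator ?B \<omega> \<partial>M)
        \<le> (\<integral>\<omega>. (\<Sum>i\<in>N0. indicator (?B \<inter> A i (Suc k)) \<omega>) \<partial>M)"
      by (intro integral_mono) (auto intro!: Bochner_Integration.integrable_sum simp: less_top[symmetric])
    also have "\<dots> = (\<Sum>i\<in>N0. prob (?B \<inter> A i (Suc k)))"
      by (subst Bochner_Integration.integral_sum) (auto simp: less_top[symmetric])
    finally have "prob ?B * real (Suc k) \<le> (\<Sum>i\<in>N0. prob (?B \<inter> A i (Suc k)))"
      by (simp add: mult.commute del: of_nat_Suc)
    then have "prob ?B \<le> (\<Sum>i\<in>N0. prob (?B \<inter> A i (Suc k))) / real (Suc k)"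
      by (simp add: pos_le_divide_eq del: of_nat_Suc)
    also have "\<dots> \<le> (\<Sum>i\<in>N0. x / n0 * (q i (Suc k) (Suc k) - q i k k))"
      unfolding sum_divide_distrib
    proof (rule sum_mono)
      fix i assume i: "i \<in> N0"
      let ?A = "A i (Suc k)"
      have "?B \<inter> ?A = E (Suc k) \<inter> ?A - E k \<inter> ?A"
        by auto
      then have diff: "prob (?B \<inter> ?A) = prob (E (Suc k) \<inter> ?A) - prob (E k \<inter> ?A)"
        using i E_mono by (auto intro!: finite_measure_Diff)
      have "prob (?B \<inter> ?A) / Suc k \<le> x / n0 * (q i (Suc k) (Suc k) - q i k (Suc k))"
      proof (cases "prob ?A = 0")
        case True
        then have "prob (?B \<inter> ?A) = 0"
          using finite_measure_mono[of "?B \<inter> ?A" ?A] i by (auto simp: measure_le_0_iff)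
        with True show ?thesis
          by (simp add: q_def)
      next
        case False
        then have pos: "prob ?A > 0"
          by (simp add: zero_less_measure_iff)
        \<comment> \<open>A factor 1 is inserted so that its numerator can be bounded by
          \<open>t (Suc k) = x * Suc k / n0\<close>, which cancels \<open>Suc k\<close>.\<close>
        have "prob (?B \<inter> ?A) / Suc k * (prob ?A / prob ?A) \<le> prob (?B \<inter> ?A) / Suc k * (t (Suc k) / prob ?A)"
          using prob_A[OF i k] pos by (intro mult_left_mono divide_right_mono) auto
        also have "\<dots> = x / n0 * (prob (?B \<inter> ?A) / prob ?A)"
          by (simp add: t_def n0_def)
        finally show ?thesis
          using pos by (simp add: diff q_def diff_divide_distrib)
      qed
      also have "\<dots> \<le> x / n0 * (q i (Suc k) (Suc k) - q i k k)"
        using q_mono[OF i k] x by (intro mult_left_mono) auto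
      finally show "prob (?B \<inter> ?A) / Suc k \<le> x / n0 * (q i (Suc k) (Suc k) - q i k k)" .
    qed
    finally show ?thesis .
  qed
  \<comment> \<open>The increasing chain runs from \<open>E 0\<close>, where the Simes test does not
    reject, to the whole space, since no rank exceeds \<open>n0\<close>. The rejection probability
    is therefore the sum of the increments bounded in \<open>step\<close>.\<close>
  have "E n0 = space M"
    by (auto simp: E_def)
  have "E 0 = {\<omega>\<in>space M. \<not> (\<exists>k\<in>{1..card N0}. k \<le> card {j\<in>N0. p j \<omega> \<le> t k})}"
    unfolding E_def cnt_def n0_def by (simp add: not_le Ball_def Suc_le_eq)
  then have "{\<omega>\<in>space M. \<exists>k\<in>{1..card N0}. k \<le> card {j\<in>N0. p j \<omega> \<le> t k}} = space M - E 0"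
    by blast
  then have "measure M {\<omega>\<in>space M. \<exists>k\<in>{1..card N0}. k \<le> card {j\<in>N0. p j \<omega> \<le> t k}}
      = prob (E n0) - prob (E 0)"
    using \<open>E n0 = space M\<close> by (simp add: prob_compl prob_space)
  also have "\<dots> = (\<Sum>k<n0. prob (E (Suc k)) - prob (E k))"
    by (rule sum_lessThan_telescope[symmetric])
  also have "\<dots> = (\<Sum>k<n0. prob (E (Suc k) - E k))"
    using E_mono by (simp add: finite_measure_Diff)
  also have "\<dots> \<le> (\<Sum>k<n0. \<Sum>i\<in>N0. x / n0 * (q i (Suc k) (Suc k) - q i k k))"
    by (intro sum_mono step) auto
  also have "\<dots> = (\<Sum>i\<in>N0. x / n0 * (\<Sum>k<n0. q i (Suc k) (Suc k) - q i k k))"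
    by (subst sum.swap) (simp add: sum_distrib_left)
  also have "\<dots> = (\<Sum>i\<in>N0. x / n0 * (q i n0 n0 - q i 0 0))"
    by (simp add: sum_lessThan_telescope[of "\<lambda>k. q _ k k"])
  also have "\<dots> \<le> (\<Sum>i\<in>N0. x / n0 * 1)"
  proof (intro sum_mono mult_left_mono)
    fix i assume "i \<in> N0"
    then have "q i n0 n0 \<le> 1"
      unfolding q_def by (intro divide_le_eq_1[THEN iffD2]) (auto intro!: finite_measure_mono simp: zero_less_measure_iff)
    moreover have "0 \<le> q i 0 0"
      by (simp add: q_def)
    ultimately show "q i n0 n0 - q i 0 0 \<le> 1"
      by simp
  qed (use x in auto)
  \<comment> \<open>Equality for nonempty \<open>N0\<close>; for empty \<open>N0\<close> the sum is
    0.\<close>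
  also have "\<dots> \<le> x"
    using x by (simp add: n0_def)
  finally show ?thesis .
qed

section \<open>FDR of compliant procedures\<close>

text \<open>A statement about a single outcome, with rejected set \<open>S\<close> and p-values
  \<open>y\<close>. The witness \<open>k\<close> is the number \<open>V\<close> of null elements of
  \<open>S\<close>, positive because \<open>u > 0\<close>. The threshold comparison combines
  \<open>card S \<le> V / u\<close> with \<open>card N0 \<le> n\<close>.\<close>

lemma FDP_ge_imp_Simes:
  assumes "N0 \<subseteq> {1..n}" "S \<subseteq> {1..n}" "0 \<le> \<alpha>" "0 < u"
    and comp: "\<forall>j\<in>S. y j \<le> \<alpha> * real (card S) / real n"
    and FDP: "u \<le> real (card (S \<inter> N0)) / real (max (card S) 1)"
  shows "\<exists>k\<in>{1..card N0}. k \<le> card {j\<in>N0. y j \<le> \<alpha> / u * real k / real (card N0)}"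
proof -
  define V where "V = card (S \<inter> N0)"
  have fin: "finite S" "finite N0"
    using assms(1,2) by (auto intro: finite_subset)
  have "V > 0"
    using FDP \<open>0 < u\<close> by (intro Nat.gr0I) (auto simp: V_def)
  moreover have "V \<le> card N0" "V \<le> card S" "card N0 \<le> n"
    using fin assms(1) card_mono[of "{1..n}" N0] by (auto simp: V_def intro: card_mono)
  moreover have "y j \<le> \<alpha> / u * real V / real (card N0)" if "j \<in> S" for j
  proof -
    have "y j \<le> \<alpha> * real (card S) / real n"
      using comp that by blast
    also have "\<dots> \<le> \<alpha> * (real V / u) / real (card N0)"
    proof (intro frac_le mult_left_mono mult_nonneg_nonneg)
      have "max (card S) 1 = card S"
        using \<open>V > 0\<close> \<open>V \<le> card S\<close> by simp
      then show "real (card S) \<le> real V / u"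
        using FDP \<open>0 < u\<close> \<open>V > 0\<close> \<open>V \<le> card S\<close> by (simp add: V_def field_simps)
    qed (use \<open>0 \<le> \<alpha>\<close> \<open>0 < u\<close> \<open>V > 0\<close> \<open>V \<le> card N0\<close> \<open>card N0 \<le> n\<close> in auto)
    finally show ?thesis
      by simp
  qed
  then have "V \<le> card {j\<in>N0. y j \<le> \<alpha> / u * real V / real (card N0)}"
    unfolding V_def using fin by (intro card_mono) auto
  ultimately show ?thesis
    by (intro bexI[of _ V]) auto
qed

lemma FDR_compliant_le:
  assumes "prob_space M" and N0: "N0 \<subseteq> {1..n}" and pv: "p_values M n N0 p"
    and PRDN: "PRDN M N0 p" and \<alpha>: "0 < \<alpha>" "\<alpha> < 1"
    and Rej: "testing_procedure M n Rej" and comp: "compliant M n p \<alpha> Rej"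
  shows "FDR M N0 Rej \<le> \<alpha> + \<alpha> * ln (1 / \<alpha>)"
  unfolding FDR_def
proof (rule prob_space.integral_le_log_of_tail_bound)
  interpret prob_space M by fact
  have sub: "Rej \<omega> \<subseteq> {1..n}" if "\<omega> \<in> space M" for \<omega>
    using measurable_space[OF Rej[unfolded testing_procedure_def] that] by simp
  let ?FDP = "\<lambda>S. real (card (S \<inter> N0)) / real (max (card S) 1)"
  have "(\<lambda>\<omega>. ?FDP (Rej \<omega>)) = ?FDP \<circ> Rej"
    by auto
  also have "\<dots> \<in> borel_measurable M"
    using Rej unfolding testing_procedure_def by (rule measurable_comp) simp
  finally show "(\<lambda>\<omega>. ?FDP (Rej \<omega>)) \<in> borel_measurable M" .
  show "0 \<le> ?FDP (Rej \<omega>) \<and> ?FDP (Rej \<omega>) \<le> 1" if "\<omega> \<in> space M" for \<omega>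
    using card_mono[of "Rej \<omega>" "Rej \<omega> \<inter> N0"] finite_subset[OF sub[OF that]]
    by (auto simp: divide_le_eq max_def)
  \<comment> \<open>For these \<open>u\<close> the level \<open>\<alpha> / u\<close> lies in (0, 1),
    so \<open>Simes_PRDN\<close> applies to it.\<close>
  fix u assume u: "\<alpha> < u" "u \<le> 1"
  have [measurable]: "p j \<in> borel_measurable M" if "j \<in> N0" for j
    using pv N0 that by (auto simp: p_values_def)
  have "prob {\<omega>\<in>space M. u \<le> ?FDP (Rej \<omega>)} \<le> prob {\<omega>\<in>space M.
      \<exists>k\<in>{1..card N0}. k \<le> card {j\<in>N0. p j \<omega> \<le> \<alpha> / u * real k / real (card N0)}}"
  proof (rule finite_measure_mono)
    show "{\<omega>\<in>space M. u \<le> ?FDP (Rej \<omega>)} \<subseteq> {\<omega>\<in>space M.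
      \<exists>k\<in>{1..card N0}. k \<le> card {j\<in>N0. p j \<omega> \<le> \<alpha> / u * real k / real (card N0)}}"
      using FDP_ge_imp_Simes[OF N0 sub, of _ \<alpha> u] comp u \<alpha>
      unfolding compliant_def by fastforce
  qed measurable
  also have "\<dots> \<le> \<alpha> / u"
    using assms(1) N0 pv PRDN u \<alpha> by (intro Simes_PRDN) auto
  finally show "prob {\<omega>\<in>space M. u \<le> ?FDP (Rej \<omega>)} \<le> \<alpha> / u" .
qed (use assms in auto)

section \<open>BH is compliant and measurable\<close>

text \<open>In a sorted list the entries at most \<open>c\<close> form an initial segment, so entry
  \<open>j - 1\<close>, counting from 0, belongs to it exactly when the segment has length at least
  \<open>j\<close>.\<close>

lemma order_stat_le_iff:
  assumes "j \<in> {1..n}"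
  shows "order_stat n x j \<le> c \<longleftrightarrow> j \<le> card {i\<in>{1..n}. x i \<le> c}"
proof -
  define xs where "xs = sort (map x [1..<Suc n])"
  have len: "length xs = n"
    by (simp add: xs_def)
  have "card {i\<in>{1..n}. x i \<le> c} = length (filter (\<lambda>i. x i \<le> c) [1..<Suc n])"
    by (subst distinct_length_filter) (auto intro!: arg_cong[where f=card])
  also have "\<dots> = length (filter (\<lambda>v. v \<le> c) xs)"
    by (simp add: xs_def filter_sort filter_map comp_def del: upt_Suc)
  also have "\<dots> = card {i. i < n \<and> xs ! i \<le> c}"
    by (simp add: length_filter_conv_card len)
  finally have card_eq: "card {i\<in>{1..n}. x i \<le> c} = card {i. i < n \<and> xs ! i \<le> c}" .
  have mono: "xs ! i \<le> xs ! l" if "i \<le> l" "l < n" for i l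
    using that len by (intro sorted_nth_mono) (auto simp: xs_def)
  show ?thesis
  proof (cases "xs ! (j - 1) \<le> c")
    case True
    then have "{..<j} \<subseteq> {i. i < n \<and> xs ! i \<le> c}"
      using assms by (auto intro!: order_trans[OF mono True])
    from card_mono[OF _ this] True show ?thesis
      unfolding card_eq by (simp add: order_stat_def xs_def del: upt_Suc)
  next
    case False
    then have "{i. i < n \<and> xs ! i \<le> c} \<subseteq> {..<j - 1}"
      using assms by (auto simp: not_le[symmetric]) (meson mono not_le order_trans)
    from card_mono[OF _ this] have "card {i\<in>{1..n}. x i \<le> c} < j"
      unfolding card_eq using assms by auto
    with False show ?thesis
      by (simp add: order_stat_def xs_def del: upt_Suc)
  qed
qed

text \<open>The maximum satisfies its own defining condition, so at least that many p-values lie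
  below its threshold. The inequality suffices for compliance, because the permitted threshold grows
  with the number of rejections.\<close>

lemma BH_count_in:
  assumes "BH_count n \<alpha> x \<noteq> 0"
  shows "BH_count n \<alpha> x \<in> {1..n}"
    and "BH_count n \<alpha> x \<le> card (BH n \<alpha> x)"
proof -
  let ?k = "BH_count n \<alpha> x"
  let ?S = "{j \<in> {1..n}. order_stat n x j \<le> \<alpha> * real j / real n}"
  have "?S \<noteq> {}" "?k = Max ?S"
    using assms by (auto simp: BH_count_def Let_def split: if_splits)
  then have k: "?k \<in> ?S"
    using Max_in[of ?S] by simp
  then show "?k \<in> {1..n}" by simp
  with k have "?k \<le> card {i\<in>{1..n}. x i \<le> \<alpha> * real ?k / real n}"
    using order_stat_le_iff by blast
  then show "?k \<le> card (BH n \<alpha> x)"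
    using assms by (simp add: BH_def)
qed

lemma compliant_BH:
  assumes "0 \<le> \<alpha>"
  shows "compliant M n p \<alpha> (\<lambda>\<omega>. BH n \<alpha> (\<lambda>j. p j \<omega>))"
  unfolding compliant_def
proof (intro ballI)
  fix \<omega> j
  let ?x = "\<lambda>j. p j \<omega>"
  assume "j \<in> BH n \<alpha> ?x"
  then have k: "BH_count n \<alpha> ?x \<noteq> 0" and "p j \<omega> \<le> \<alpha> * real (BH_count n \<alpha> ?x) / real n"
    by (auto simp: BH_def split: if_splits)
  note this(2)
  also have "\<dots> \<le> \<alpha> * real (card (BH n \<alpha> ?x)) / real n"
    using BH_count_in(2)[OF k] assms by (intro divide_right_mono mult_left_mono) auto
  finally show "p j \<omega> \<le> \<alpha> * real (card (BH n \<alpha> ?x)) / real n" .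
qed

text \<open>The thresholds increase with \<open>k\<close>, so lying below the threshold of some
  admissible \<open>k\<close> is the same as lying below that of the largest. This removes sorting
  and \<open>Max\<close> and leaves finitely many counting conditions, whose measurability is
  immediate.\<close>

lemma mem_BH_iff:
  assumes "0 \<le> \<alpha>"
  shows "j \<in> BH n \<alpha> x \<longleftrightarrow> j \<in> {1..n} \<and>
    (\<exists>k\<in>{1..n}. k \<le> card {i\<in>{1..n}. x i \<le> \<alpha> * real k / real n} \<and> x j \<le> \<alpha> * real k / real n)"
    (is "_ \<longleftrightarrow> _ \<and> (\<exists>k\<in>_. ?P k \<and> x j \<le> ?c k)")
proof -
  define K where "K = {k \<in> {1..n}. order_stat n x k \<le> ?c k}"
  have K_iff: "k \<in> K \<longleftrightarrow> k \<in> {1..n} \<and> ?P k" for k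
    by (auto simp: K_def order_stat_le_iff)
  have ex_iff: "(\<exists>k\<in>{1..n}. ?P k \<and> x j \<le> ?c k) \<longleftrightarrow> (\<exists>k\<in>K. x j \<le> ?c k)"
    unfolding Bex_def K_iff by simp
  show ?thesis
  proof (cases "K = {}")
    case True
    then have "BH n \<alpha> x = {}"
      by (simp add: BH_def BH_count_def K_def)
    with True show ?thesis
      unfolding ex_iff by simp
  next
    case False
    then have eq: "BH_count n \<alpha> x = Max K"
      unfolding BH_count_def Let_def K_def by (simp only: if_False)
    have "finite K"
      by (simp add: K_def)
    then have Max_in: "Max K \<in> K"
      using False by (rule Max_in)
    have "?c k \<le> ?c (Max K)" if "k \<in> K" for k
      using assms \<open>finite K\<close> that by (intro divide_right_mono mult_left_mono) auto
    with Max_in have "(\<exists>k\<in>K. x j \<le> ?c k) \<longleftrightarrow> x j \<le> ?c (Max K)"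
      by (blast intro: order_trans)
    moreover have "Max K \<noteq> 0"
      using Max_in by (auto simp: K_def)
    ultimately show ?thesis
      unfolding ex_iff by (simp add: BH_def eq)
  qed
qed

lemma testing_procedure_BH:
  assumes p: "\<And>j. j \<in> {1..n} \<Longrightarrow> p j \<in> borel_measurable M" and "0 \<le> \<alpha>"
  shows "testing_procedure M n (\<lambda>\<omega>. BH n \<alpha> (\<lambda>j. p j \<omega>))"
  unfolding testing_procedure_def
proof (subst measurable_count_space_eq2, simp, intro conjI ballI)
  note p[measurable]
  let ?B = "\<lambda>\<omega>. BH n \<alpha> (\<lambda>j. p j \<omega>)"
  have sub: "?B \<omega> \<subseteq> {1..n}" for \<omega>
    by (auto simp: BH_def)
  then show "?B \<in> space M \<rightarrow> Pow {1..n}"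
    by blast
  fix S assume "S \<in> Pow {1..n}"
  \<comment> \<open>The range is finite, so preimages of singletons suffice, and each is a finite
    combination of membership events.\<close>
  then have "?B -` {S} \<inter> space M = {\<omega>\<in>space M. \<forall>j\<in>{1..n}. j \<in> ?B \<omega> \<longleftrightarrow> j \<in> S}"
    using sub by blast
  also have "\<dots> \<in> sets M"
    unfolding mem_BH_iff[OF \<open>0 \<le> \<alpha>\<close>] by measurable
  finally show "?B -` {S} \<inter> space M \<in> sets M" .
qed

theorem theorem3:
  fixes M :: "'a measure" and n :: nat and N0 :: "nat set"
    and p :: "nat \<Rightarrow> 'a \<Rightarrow> real" and \<alpha> :: real
  assumes "prob_space M"
    and "N0 \<subseteq> {1..n}" and "card N0 \<ge> 1"
    and "p_values M n N0 p"
    and "0 < \<alpha>" and "\<alpha> < 1"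
    and "PRDN M N0 p"
  shows "(\<forall>Rej. testing_procedure M n Rej \<and> compliant M n p \<alpha> Rej \<longrightarrow>
            FDR M N0 Rej \<le> \<alpha> + \<alpha> * ln (1 / \<alpha>)) \<and>
         FDR M N0 (\<lambda>\<omega>. BH n \<alpha> (\<lambda>j. p j \<omega>)) \<le> \<alpha> + \<alpha> * ln (1 / \<alpha>)"
proof -
  have bound: "FDR M N0 Rej \<le> \<alpha> + \<alpha> * ln (1 / \<alpha>)"
    if "testing_procedure M n Rej" "compliant M n p \<alpha> Rej" for Rej
    using FDR_compliant_le assms that by blast
  moreover have "testing_procedure M n (\<lambda>\<omega>. BH n \<alpha> (\<lambda>j. p j \<omega>))"
    using assms(4,5) by (intro testing_procedure_BH) (auto simp: p_values_def)
  ultimately show ?thesis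
    using compliant_BH[of \<alpha> M n p] assms(5) by auto
qed

end
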